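(* Let $X$ be a finite-dimensional Banach space, let $E$ be a direction set in $X$ of cardinality $2k$, and let $\mathcal{F}$ be a complete, symmetric, simplicial $E$-fan. Then $(\mathcal{R}'(\mathcal{F}),d_H)$ and $(\mathcal{N}'(\mathcal{F}),d)$ are complete metric spaces.
   Context: $\mathcal{N}(X)$ is the set of equivalent norms on $X$. A direction set in $(X,\|\cdot\|)$ is a finite subset $E\subset S_X$ of the unit sphere with $E=-E$ and $\operatorname{conv}(E)$ having nonempty interior; choosing one representative from each antipodal pair, write $E=\{\pm x_1,\dots,\pm x_k\}$ (cardinality $2k$). A fan $\mathcal{F}$ in $X$ is a finite collection of polyhedral cones, closed under taking faces, such that the intersection of any two of its cones is a face of both. It is simplicial if every cone is generated by a linearly independent set, complete if its cones cover $X$, symmetric if $-C\in\mathcal{F}$ whenever $C\in\mathcal{F}$, and an $E$-fan if every cone of $\mathcal{F}$ is generated by rays determined by elements of $E$. For a complete, symmetric, simplicial $E$-fan $\mathcal{F}$ and a symmetric weight $\alpha:E\to(0,\infty)$ (i.e. $\alpha(-x)=\alpha(x)$), the pair $(\mathcal{F},\alpha)$ is $E$-admissible if for every maximal cone $C=\operatorname{cone}(x_{n_1},\dots,x_{n_d})\in\mathcal{F}$ ($d=\dim X$, generators in $E$) the unique $\ell_C^\alpha\in X^*$ with $\ell_C^\alpha(x_{n_j})=\alpha(x_{n_j})$ for $j=1,\dots,d$ satisfies $\ell_C^\alpha(x_i)\le\alpha(x_i)$ for every $x_i\in E$. Symmetric weights on $E$ are identified with multiindices via $\alpha\leftrightarrow(\alpha(x_1),\dots,\alpha(x_k))\in\mathbb{R}^k_{>0}$.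 $\mathcal{N}(\mathcal{F})=\{p\in\mathcal{N}(X): p\text{ is linear on every cone }C\in\mathcal{F}\}$ (linear on $C$ means coinciding on $C$ with a linear functional), and $\mathcal{R}(\mathcal{F})$ is the set of symmetric weights $\alpha:E\to(0,\infty)$ with $(\mathcal{F},\alpha)$ $E$-admissible. $\mathcal{N}'(\mathcal{F})$ and $\mathcal{R}'(\mathcal{F})$ are the quotients of these by the relation $x\sim y\iff y=cx$ for some $c>0$; a bar denotes the class of an element. For $p,q\in\mathcal{N}(X)$, $d(\overline p,\overline q)=\log(u/l)$, where $u\ge l>0$ are the optimal constants with $l\,p\le q\le u\,p$ on $X$. On $\mathbb{R}^k_{>0}/\sim$ the Hilbert metric is $d_H(\overline\alpha,\overline\beta)=\log\big(\max_i\frac{\alpha_i}{\beta_i}\big/\min_i\frac{\alpha_i}{\beta_i}\big)$. *)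

theory Defs
  imports "HOL-Analysis.Analysis"
begin

section \<open>Direction sets and fans\<close>

definition direction_set :: "'a::real_normed_vector set \<Rightarrow> bool" where
  "direction_set E \<longleftrightarrow>
     finite E \<and> E \<subseteq> sphere 0 1 \<and> uminus ` E = E \<and> interior (convex hull E) \<noteq> {}"

definition polyhedral_cone :: "'a::real_vector set \<Rightarrow> bool" where
  "polyhedral_cone C \<longleftrightarrow> (\<exists>G. finite G \<and> C = convex_cone hull G)"

text \<open>The empty set is a face of every convex set in the sense of \<^const>\<open>face_of\<close>, but it is
  not a face of a cone in the sense of polyhedral geometry, hence the condition \<open>T \<noteq> {}\<close>.
  The intersection of two cones contains 0, so no such condition is needed there.\<close>

definition fan :: "'a::real_vector set set \<Rightarrow> bool" where
  "fan F \<longleftrightarrow>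
     finite F \<and>
     (\<forall>C\<in>F. polyhedral_cone C) \<and>
     (\<forall>C\<in>F. \<forall>T. T face_of C \<and> T \<noteq> {} \<longrightarrow> T \<in> F) \<and>
     (\<forall>C\<in>F. \<forall>D\<in>F. (C \<inter> D) face_of C \<and> (C \<inter> D) face_of D)"

definition simplicial_fan :: "'a::real_vector set set \<Rightarrow> bool" where
  "simplicial_fan F \<longleftrightarrow> fan F \<and> (\<forall>C\<in>F. \<exists>G. independent G \<and> C = convex_cone hull G)"

definition complete_fan :: "'a::real_vector set set \<Rightarrow> bool" where
  "complete_fan F \<longleftrightarrow> fan F \<and> \<Union>F = UNIV"

definition symmetric_fan :: "'a::real_vector set set \<Rightarrow> bool" where
  "symmetric_fan F \<longleftrightarrow> fan F \<and> (\<forall>C\<in>F. uminus ` C \<in> F)"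

definition E_fan :: "'a::real_vector set \<Rightarrow> 'a set set \<Rightarrow> bool" where
  "E_fan E F \<longleftrightarrow> fan F \<and> (\<forall>C\<in>F. \<exists>G\<subseteq>E. C = convex_cone hull G)"

definition maximal_cone :: "'a set set \<Rightarrow> 'a set \<Rightarrow> bool" where
  "maximal_cone F C \<longleftrightarrow> C \<in> F \<and> (\<forall>D\<in>F. C \<subseteq> D \<longrightarrow> D = C)"

section \<open>Admissible weights and the norms of a fan\<close>

definition symmetric_weights :: "'a::real_vector set \<Rightarrow> ('a \<Rightarrow> real) set" where
  "symmetric_weights E = {\<alpha> \<in> E \<rightarrow>\<^sub>E {0<..}. \<forall>x\<in>E. \<alpha> (- x) = \<alpha> x}"

text \<open>The functional \<open>\<ell>\<^sub>C\<^sup>\<alpha>\<close> of the cone \<open>C\<close> generated by \<open>G\<close>; it is uniquely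
  determined when \<open>G\<close> is a basis.\<close>

definition cone_functional :: "'a::real_normed_vector set \<Rightarrow> ('a \<Rightarrow> real) \<Rightarrow> 'a \<Rightarrow>\<^sub>L real" where
  "cone_functional G \<alpha> = (THE l. \<forall>x\<in>G. blinfun_apply l x = \<alpha> x)"

definition E_admissible ::
    "'a::real_normed_vector set \<Rightarrow> 'a set set \<Rightarrow> ('a \<Rightarrow> real) \<Rightarrow> bool" where
  "E_admissible E F \<alpha> \<longleftrightarrow>
     (\<forall>C G. maximal_cone F C \<and> G \<subseteq> E \<and> independent G \<and> card G = dim (UNIV :: 'a set) \<and>
            C = convex_cone hull G \<longrightarrow>
        (\<forall>x\<in>E. blinfun_apply (cone_functional G \<alpha>) x \<le> \<alpha> x))"

definition admissible_weights ::
    "'a::real_normed_vector set \<Rightarrow> 'a set set \<Rightarrow> ('a \<Rightarrow> real) set" where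
  "admissible_weights E F = {\<alpha> \<in> symmetric_weights E. E_admissible E F \<alpha>}"

definition equivalent_norms :: "('a::real_normed_vector \<Rightarrow> real) set" where
  "equivalent_norms =
     {p. (\<forall>x. p x = 0 \<longleftrightarrow> x = 0) \<and>
         (\<forall>x y. p (x + y) \<le> p x + p y) \<and>
         (\<forall>c x. p (c *\<^sub>R x) = \<bar>c\<bar> * p x) \<and>
         (\<exists>a>0. \<exists>b>0. \<forall>x. a * norm x \<le> p x \<and> p x \<le> b * norm x)}"

definition fan_norms :: "'a::real_normed_vector set set \<Rightarrow> ('a \<Rightarrow> real) set" where
  "fan_norms F = {p \<in> equivalent_norms. \<forall>C\<in>F. \<exists>l. linear l \<and> (\<forall>x\<in>C. p x = l x)}"

section \<open>Quotients by positive scaling and their metrics\<close>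

text \<open>\<open>D\<close> is the domain of the functions in \<open>S\<close>.\<close>

definition proportionality :: "'a set \<Rightarrow> ('a \<Rightarrow> real) set \<Rightarrow> (('a \<Rightarrow> real) \<times> ('a \<Rightarrow> real)) set" where
  "proportionality D S = {(f, g). f \<in> S \<and> g \<in> S \<and> (\<exists>c>0. \<forall>x\<in>D. g x = c * f x)}"

definition admissible_weight_classes ::
    "'a::real_normed_vector set \<Rightarrow> 'a set set \<Rightarrow> ('a \<Rightarrow> real) set set" where
  "admissible_weight_classes E F =
     admissible_weights E F // proportionality E (admissible_weights E F)"

definition fan_norm_classes :: "'a::real_normed_vector set set \<Rightarrow> ('a \<Rightarrow> real) set set" where
  "fan_norm_classes F = fan_norms F // proportionality UNIV (fan_norms F)"

text \<open>The function induced on a set \<open>Q\<close> of classes by a function \<open>d\<close> of representatives.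
  The use of \<^const>\<open>the_elem\<close> makes it meaningful only if \<open>d\<close> does not depend on the
  representatives. The value 0 outside \<open>Q\<close> is a convention: \<^locale>\<open>Metric_space\<close> requires
  nonnegativity and symmetry also outside the carrier.\<close>

definition class_dist :: "'b set set \<Rightarrow> ('b \<Rightarrow> 'b \<Rightarrow> real) \<Rightarrow> 'b set \<Rightarrow> 'b set \<Rightarrow> real" where
  "class_dist Q d A B =
     (if A \<in> Q \<and> B \<in> Q then the_elem {d f g | f g. f \<in> A \<and> g \<in> B} else 0)"

definition norm_dist :: "('a \<Rightarrow> real) \<Rightarrow> ('a \<Rightarrow> real) \<Rightarrow> real" where
  "norm_dist p q =
     (let l = Sup {l. 0 < l \<and> (\<forall>x. l * p x \<le> q x)};
          u = Inf {u. 0 < u \<and> (\<forall>x. q x \<le> u * p x)}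
      in ln (u / l))"

definition hilbert_dist :: "nat \<Rightarrow> (nat \<Rightarrow> real) \<Rightarrow> (nat \<Rightarrow> real) \<Rightarrow> real" where
  "hilbert_dist k a b =
     ln (Max ((\<lambda>i. a i / b i) ` {1..k}) / Min ((\<lambda>i. a i / b i) ` {1..k}))"

text \<open>The Hilbert metric on symmetric weights, identified with multiindices through an
  enumeration \<open>x\<^sub>1, \<dots>, x\<^sub>k\<close> of representatives of the antipodal pairs.\<close>

definition weight_dist :: "nat \<Rightarrow> (nat \<Rightarrow> 'a) \<Rightarrow> ('a \<Rightarrow> real) \<Rightarrow> ('a \<Rightarrow> real) \<Rightarrow> real" where
  "weight_dist k x \<alpha> \<beta> = hilbert_dist k (\<lambda>i. \<alpha> (x i)) (\<lambda>i. \<beta> (x i))"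

end

theory Submission
  imports Defs
begin

text \<open>
  Both metrics are instances of Hilbert's projective metric. For functions \<open>f\<close>, \<open>g\<close> that are
  positive on a set \<open>D\<close> (the nonzero vectors for norms, the directions \<open>E\<close> for weights), the
  distance is the oscillation of \<open>ln (f / g)\<close> over \<open>D\<close>, that is,
  \[ d(f,g) \le r \iff f(x)\,g(y) \le e^r f(y)\,g(x) \quad\mbox{for all } x, y \in D. \]
  This family of inequalities is homogeneous in \<open>f\<close> and in \<open>g\<close>, so \<open>d\<close> lives on classes of
  proportional functions, and the metric axioms can be read off from it.

  For completeness, take representatives \<open>f\<^sub>n\<close> of a Cauchy sequence and normalise them at a fixed
  point \<open>e\<close> of \<open>D\<close>. The inequality with \<open>y = e\<close> says that \<open>ln (f\<^sub>n(x) / f\<^sub>n(e))\<close> is Cauchy, so the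
  normalised functions converge pointwise to a positive function \<open>h\<close>. Passing to the limit in the
  inequalities gives \<open>d(f\<^sub>n, h) \<rightarrow> 0\<close>, and also that \<open>h\<close> is squeezed between two
  positive multiples of some \<open>f\<^sub>n\<close>. Hence a set of functions has complete quotient as soon as it
  is closed under such limits of rescaled sequences (locale \<open>projective_metric\<close>).

  It remains to see that the two sets are closed. For norms, the norm axioms pass to pointwise limits,
  equivalence with the given norm is inherited through the squeezing, and linearity on a
  cone with linearly independent generators amounts to being additive and positively homogeneous there
  (\<open>linear_on_simplicial_cone_limit\<close>). For weights, \<open>\<ell>\<^sub>C\<^sup>\<alpha>(x)\<close> is the sum of the coordinates
  of \<open>x\<close> in the basis generating \<open>C\<close>, weighted by \<open>\<alpha>\<close> (\<open>cone_functional_coordinates\<close>),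
  so admissibility is a finite system of homogeneous weak linear inequalities in \<open>\<alpha>\<close>.
\<close>

section \<open>Hilbert's projective metric on classes of positive functions\<close>

text \<open>The distance is given only through its sublevel sets: this is the form in which scaling
  invariance and the metric axioms are evident, and it hides whether \<open>d\<close> was built
  from suprema or from maxima. In \<open>closed\<close> the lower comparison with \<open>f N\<close> cannot be dropped
  for norms on an arbitrary space, as a pointwise limit of equivalent norms can degenerate.\<close>

locale projective_metric =
  fixes D :: "'a set" and S :: "('a \<Rightarrow> real) set" and d :: "('a \<Rightarrow> real) \<Rightarrow> ('a \<Rightarrow> real) \<Rightarrow> real"
  assumes nonempty: "D \<noteq> {}"
    and pos: "\<And>f x. f \<in> S \<Longrightarrow> x \<in> D \<Longrightarrow> 0 < f x"
    and le_iff: "\<And>f g r. f \<in> S \<Longrightarrow> g \<in> S \<Longrightarrow>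
      d f g \<le> r \<longleftrightarrow> (\<forall>x\<in>D. \<forall>y\<in>D. f x * g y \<le> exp r * (f y * g x))"
    and closed: "\<And>f c h N a b. (\<And>n::nat. f n \<in> S) \<Longrightarrow> (\<And>n. 0 < c n) \<Longrightarrow>
      (\<And>x. x \<in> D \<Longrightarrow> (\<lambda>n. c n * f n x) \<longlonglongrightarrow> h x) \<Longrightarrow> (\<And>x. x \<in> D \<Longrightarrow> 0 < h x) \<Longrightarrow>
      0 < a \<Longrightarrow> 0 < b \<Longrightarrow> (\<And>x. x \<in> D \<Longrightarrow> a * f N x \<le> h x \<and> h x \<le> b * f N x) \<Longrightarrow>
      \<exists>g\<in>S. \<forall>x\<in>D. g x = h x"
begin

abbreviation "Q \<equiv> S // proportionality D S"
abbreviation "dQ \<equiv> class_dist Q d"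

lemma ineq: "f \<in> S \<Longrightarrow> g \<in> S \<Longrightarrow> x \<in> D \<Longrightarrow> y \<in> D \<Longrightarrow> f x * g y \<le> exp (d f g) * (f y * g x)"
  using le_iff[of f g "d f g"] by simp

lemma dist_nonneg: assumes "f \<in> S" "g \<in> S" shows "0 \<le> d f g"
proof -
  obtain e where e: "e \<in> D" using nonempty by blast
  have "1 * (f e * g e) \<le> exp (d f g) * (f e * g e)" using ineq[OF assms e e] by simp
  moreover have "0 < f e * g e" using pos assms e by simp
  ultimately have "1 \<le> exp (d f g)" by (simp only: mult_le_cancel_right_pos)
  then show ?thesis by simp
qed

lemma dist_sym: assumes "f \<in> S" "g \<in> S" shows "d f g = d g f"
proof -
  have "d f g \<le> r \<longleftrightarrow> d g f \<le> r" for r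
    unfolding le_iff[OF assms] le_iff[OF assms(2,1)] by (auto simp: mult.commute)
  from this[of "d f g"] this[of "d g f"] show ?thesis by simp
qed

lemma dist_triangle: assumes "f \<in> S" "g \<in> S" "h \<in> S" shows "d f h \<le> d f g + d g h"
proof -
  have "f x * h y \<le> exp (d f g + d g h) * (f y * h x)" if xy: "x \<in> D" "y \<in> D" for x y
  proof -
    have p: "0 < f x" "0 < f y" "0 < g x" "0 < g y" "0 < h x" "0 < h y"
      using pos assms xy by auto
    have "(f x * g y) * (g x * h y)
        \<le> (exp (d f g) * (f y * g x)) * (exp (d g h) * (g y * h x))"
      by (rule mult_mono) (use ineq assms xy p in auto)
    then have "(f x * h y) * (g x * g y) \<le> (exp (d f g + d g h) * (f y * h x)) * (g x * g y)"
      by (simp add: exp_add mult_ac)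
    moreover have "0 < g x * g y" using p by simp
    ultimately show ?thesis by (simp only: mult_le_cancel_right_pos)
  qed
  then show ?thesis using le_iff assms by blast
qed

lemma dist_proportional:
  assumes "(f, f') \<in> proportionality D S" "(g, g') \<in> proportionality D S"
  shows "d f g = d f' g'"
proof -
  obtain a b where ab: "0 < a" "0 < b" "\<And>x. x \<in> D \<Longrightarrow> f' x = a * f x" "\<And>x. x \<in> D \<Longrightarrow> g' x = b * g x"
    and S: "f \<in> S" "f' \<in> S" "g \<in> S" "g' \<in> S"
    using assms unfolding proportionality_def by auto
  have "f' x * g' y \<le> exp r * (f' y * g' x) \<longleftrightarrow> f x * g y \<le> exp r * (f y * g x)"
    if "x \<in> D" "y \<in> D" for x y r
  proof -
    have "f' x * g' y = (a * b) * (f x * g y)" "exp r * (f' y * g' x) = (a * b) * (exp r * (f y * g x))"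
      using ab(3,4) that by auto
    moreover have "0 < a * b" using ab by simp
    ultimately show ?thesis by (simp only: mult_le_cancel_left_pos)
  qed
  then have "d f g \<le> r \<longleftrightarrow> d f' g' \<le> r" for r
    unfolding le_iff[OF S(1,3)] le_iff[OF S(2,4)] by auto
  from this[of "d f g"] this[of "d f' g'"] show ?thesis by simp
qed

lemma dist_eq_0_iff:
  assumes "f \<in> S" "g \<in> S"
  shows "d f g = 0 \<longleftrightarrow> (f, g) \<in> proportionality D S"
proof
  assume 0: "d f g = 0"
  obtain e where e: "e \<in> D" using nonempty by blast
  have "g x = (g e / f e) * f x" if "x \<in> D" for x
  proof -
    have "f x * g e = f e * g x"
      using ineq[OF assms that e] ineq[OF assms e that] 0 by simp
    then show ?thesis using pos[OF assms(1) e] by (simp add: field_simps)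
  qed
  moreover have "0 < g e / f e" using pos assms e by simp
  ultimately show "(f, g) \<in> proportionality D S"
    unfolding proportionality_def using assms by blast
next
  assume "(f, g) \<in> proportionality D S"
  moreover have "(g, g) \<in> proportionality D S"
    unfolding proportionality_def using assms by (auto intro: exI[of _ 1])
  ultimately have "d f g = d g g" by (rule dist_proportional)
  also have "d g g \<le> 0" using le_iff assms by auto
  finally show "d f g = 0" using dist_nonneg[OF assms] by simp
qed

lemma equiv_proportionality: "equiv S (proportionality D S)"
proof (rule equivI)
  show "proportionality D S \<subseteq> S \<times> S" unfolding proportionality_def by auto
  show "refl_on S (proportionality D S)"
    unfolding refl_on_def proportionality_def by (auto intro: exI[of _ 1])
  show "sym (proportionality D S)"
  proof (rule symI)
    fix f g assume "(f, g) \<in> proportionality D S"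
    then have "f \<in> S" "g \<in> S" "d f g = 0" using dist_eq_0_iff unfolding proportionality_def by auto
    then show "(g, f) \<in> proportionality D S" using dist_eq_0_iff dist_sym by metis
  qed
  show "trans (proportionality D S)"
  proof (rule transI)
    fix f g h assume "(f, g) \<in> proportionality D S" "(g, h) \<in> proportionality D S"
    moreover from this have S: "f \<in> S" "g \<in> S" "h \<in> S" unfolding proportionality_def by auto
    ultimately have "d f g = 0" "d g h = 0" using dist_eq_0_iff[OF S(1,2)] dist_eq_0_iff[OF S(2,3)] by simp_all
    then have "d f h \<le> 0" using dist_triangle[OF S] by simp
    then have "d f h = 0" using dist_nonneg[OF S(1,3)] by simp
    then show "(f, h) \<in> proportionality D S" using dist_eq_0_iff S by simp
  qed
qed

abbreviation cls :: "('a \<Rightarrow> real) \<Rightarrow> ('a \<Rightarrow> real) set" where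
  "cls f \<equiv> proportionality D S `` {f}"

lemma class_dist_cls: assumes "f \<in> S" "g \<in> S" shows "dQ (cls f) (cls g) = d f g"
proof -
  have "{d f' g' | f' g'. f' \<in> cls f \<and> g' \<in> cls g} = {d f g}"
  proof -
    have "f \<in> cls f" "g \<in> cls g" using equiv_class_self[OF equiv_proportionality] assms by auto
    moreover have "d f' g' = d f g" if "f' \<in> cls f" "g' \<in> cls g" for f' g'
      using dist_proportional[of f f' g g'] that by simp
    ultimately show ?thesis by blast
  qed
  moreover have "cls f \<in> Q" "cls g \<in> Q" using assms by (auto intro: quotientI)
  ultimately show ?thesis unfolding class_dist_def by simp
qed

lemma Metric_space_classes: "Metric_space Q dQ"
proof
  fix A B
  show "0 \<le> dQ A B"
  proof (cases "A \<in> Q \<and> B \<in> Q")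
    case True
    then obtain f g where "f \<in> S" "g \<in> S" "A = cls f" "B = cls g" by (auto elim!: quotientE)
    then show ?thesis using class_dist_cls dist_nonneg by simp
  qed (auto simp: class_dist_def)
  show "dQ A B = dQ B A"
  proof (cases "A \<in> Q \<and> B \<in> Q")
    case True
    then obtain f g where "f \<in> S" "g \<in> S" "A = cls f" "B = cls g" by (auto elim!: quotientE)
    then show ?thesis using class_dist_cls dist_sym by simp
  qed (auto simp: class_dist_def)
next
  fix A B assume "A \<in> Q" "B \<in> Q"
  then obtain f g where fg: "f \<in> S" "g \<in> S" "A = cls f" "B = cls g" by (auto elim!: quotientE)
  show "dQ A B = 0 \<longleftrightarrow> A = B"
    using fg class_dist_cls dist_eq_0_iff eq_equiv_class_iff[OF equiv_proportionality] by simp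
next
  fix A B C assume "A \<in> Q" "B \<in> Q" "C \<in> Q"
  then obtain f g h where "f \<in> S" "g \<in> S" "h \<in> S" "A = cls f" "B = cls g" "C = cls h"
    by (auto elim!: quotientE)
  then show "dQ A C \<le> dQ A B + dQ B C" using class_dist_cls dist_triangle by simp
qed

text \<open>Rescaling by the value at a fixed point \<open>e\<close> turns a Cauchy sequence of classes into a
  sequence of functions whose logarithms are uniformly Cauchy.\<close>

lemma Cauchy_imp_limit:
  assumes S: "\<And>n. f n \<in> S"
    and Cauchy: "\<And>\<epsilon>. 0 < \<epsilon> \<Longrightarrow> \<exists>N::nat. \<forall>n\<ge>N. \<forall>m\<ge>N. d (f n) (f m) < \<epsilon>"
  obtains g where "g \<in> S" "\<And>\<epsilon>. 0 < \<epsilon> \<Longrightarrow> \<exists>N. \<forall>n\<ge>N. d (f n) g \<le> \<epsilon>"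
proof -
  obtain e where e: "e \<in> D" using nonempty by blast
  define c where "c n = 1 / f n e" for n
  define q where "q n x = c n * f n x" for n x
  have c: "0 < c n" for n unfolding c_def using pos S e by simp
  have q: "0 < q n x" if "x \<in> D" for n x unfolding q_def using c pos S that by simp
  have qe: "q n e = 1" for n unfolding q_def c_def using pos[OF S e, of n] by simp
  have qq: "q n x * q m y \<le> exp (d (f n) (f m)) * (q n y * q m x)" if xy: "x \<in> D" "y \<in> D" for n m x y
  proof -
    have "(c n * c m) * (f n x * f m y) \<le> (c n * c m) * (exp (d (f n) (f m)) * (f n y * f m x))"
      using ineq[OF S S xy, of n m] c[of n] c[of m] by (intro mult_left_mono) simp_all
    then show ?thesis unfolding q_def by (simp add: mult_ac)
  qed
  have ln_le: "ln (q n x) \<le> d (f n) (f m) + ln (q m x)" if x: "x \<in> D" for n m x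
  proof -
    have "q n x \<le> exp (d (f n) (f m)) * q m x" using qq[OF x e, of n m] by (simp add: qe)
    then have "ln (q n x) \<le> ln (exp (d (f n) (f m)) * q m x)" using q[OF x] by simp
    then show ?thesis using q[OF x, of m] by (simp add: ln_mult)
  qed
  have "\<exists>L. (\<lambda>n. ln (q n x)) \<longlonglongrightarrow> L" if x: "x \<in> D" for x
  proof -
    have "Cauchy (\<lambda>n. ln (q n x))"
    proof (rule metric_CauchyI)
      fix \<epsilon> :: real assume "0 < \<epsilon>"
      then obtain N where N: "\<forall>n\<ge>N. \<forall>m\<ge>N. d (f n) (f m) < \<epsilon>" using Cauchy by blast
      show "\<exists>N. \<forall>m\<ge>N. \<forall>n\<ge>N. dist (ln (q m x)) (ln (q n x)) < \<epsilon>"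
      proof (intro exI allI impI)
        fix m n assume "N \<le> m" "N \<le> n"
        then have "d (f n) (f m) < \<epsilon>" "d (f m) (f n) < \<epsilon>" using N by auto
        then show "dist (ln (q m x)) (ln (q n x)) < \<epsilon>"
          using ln_le[OF x, of m n] ln_le[OF x, of n m] by (simp add: dist_real_def abs_less_iff)
      qed
    qed
    then show ?thesis using Cauchy_convergent convergent_def by blast
  qed
  then obtain L where L: "\<And>x. x \<in> D \<Longrightarrow> (\<lambda>n. ln (q n x)) \<longlonglongrightarrow> L x" by metis
  define h where "h x = exp (L x)" for x
  have lim: "(\<lambda>n. q n x) \<longlonglongrightarrow> h x" if x: "x \<in> D" for x
    using tendsto_exp[OF L[OF x]] q[OF x] unfolding h_def by simp
  have h: "0 < h x" for x unfolding h_def by simp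
  have he: "h e = 1" using lim[OF e] by (simp add: qe LIMSEQ_const_iff)
  have close: "\<exists>N. \<forall>n\<ge>N. \<forall>x\<in>D. \<forall>y\<in>D. q n x * h y \<le> exp \<epsilon> * (q n y * h x)" if "0 < \<epsilon>" for \<epsilon>
  proof -
    obtain N where N: "\<forall>n\<ge>N. \<forall>m\<ge>N. d (f n) (f m) < \<epsilon>" using Cauchy \<open>0 < \<epsilon>\<close> by blast
    have "q n x * h y \<le> exp \<epsilon> * (q n y * h x)" if n: "N \<le> n" and x: "x \<in> D" and y: "y \<in> D" for n x y
    proof (rule LIMSEQ_le)
      show "(\<lambda>m. q n x * q m y) \<longlonglongrightarrow> q n x * h y" by (intro tendsto_intros lim y)
      show "(\<lambda>m. exp \<epsilon> * (q n y * q m x)) \<longlonglongrightarrow> exp \<epsilon> * (q n y * h x)" by (intro tendsto_intros lim x)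
      show "\<exists>K. \<forall>m\<ge>K. q n x * q m y \<le> exp \<epsilon> * (q n y * q m x)"
      proof (intro exI allI impI)
        fix m assume "N \<le> m"
        then have "exp (d (f n) (f m)) * (q n y * q m x) \<le> exp \<epsilon> * (q n y * q m x)"
          using N n q[OF x, of m] q[OF y, of n] by (intro mult_right_mono) (simp_all add: less_imp_le)
        then show "q n x * q m y \<le> exp \<epsilon> * (q n y * q m x)" using qq[OF x y, of n m] by linarith
      qed
    qed
    then show ?thesis by blast
  qed
  \<comment> \<open>Any fixed \<open>\<epsilon>\<close> gives positive multiples of one \<open>f N\<close> that squeeze \<open>h\<close>; here \<open>\<epsilon> = 1\<close>.\<close>
  obtain N where N: "\<And>n x y. N \<le> n \<Longrightarrow> x \<in> D \<Longrightarrow> y \<in> D \<Longrightarrow> q n x * h y \<le> exp 1 * (q n y * h x)"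
    using close[of 1] by auto
  have "\<exists>g\<in>S. \<forall>x\<in>D. g x = h x"
  proof (rule closed)
    show "f n \<in> S" "0 < c n" for n by (fact S c)+
    show "(\<lambda>n. c n * f n x) \<longlonglongrightarrow> h x" if "x \<in> D" for x using lim[OF that] unfolding q_def .
    show "0 < h x" for x by (fact h)
    show "0 < c N / exp 1" "0 < exp 1 * c N" using c by simp_all
    show "c N / exp 1 * f N x \<le> h x \<and> h x \<le> exp 1 * c N * f N x" if x: "x \<in> D" for x
    proof
      have "q N x \<le> exp 1 * h x" using N[OF order_refl x e] by (simp add: qe he)
      then show "c N / exp 1 * f N x \<le> h x" unfolding q_def by (simp add: field_simps)
      have "h x \<le> exp 1 * q N x" using N[OF order_refl e x] by (simp add: qe he)
      then show "h x \<le> exp 1 * c N * f N x" unfolding q_def by (simp add: mult_ac)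
    qed
  qed
  then obtain g where g: "g \<in> S" "\<And>x. x \<in> D \<Longrightarrow> g x = h x" by blast
  have "\<exists>N. \<forall>n\<ge>N. d (f n) g \<le> \<epsilon>" if "0 < \<epsilon>" for \<epsilon>
  proof -
    obtain N where N: "\<forall>n\<ge>N. \<forall>x\<in>D. \<forall>y\<in>D. q n x * h y \<le> exp \<epsilon> * (q n y * h x)"
      using close \<open>0 < \<epsilon>\<close> by blast
    have "d (f n) g \<le> \<epsilon>" if n: "N \<le> n" for n
      unfolding le_iff[OF S g(1)]
    proof (intro ballI)
      fix x y assume xy: "x \<in> D" "y \<in> D"
      then have "c n * (f n x * h y) \<le> c n * (exp \<epsilon> * (f n y * h x))"
        using N n unfolding q_def by (simp add: mult_ac)
      then show "f n x * g y \<le> exp \<epsilon> * (f n y * g x)"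
        using c[of n] g(2) xy by (simp only: mult_le_cancel_left_pos)
    qed
    then show ?thesis by blast
  qed
  then show thesis using that g(1) by blast
qed

theorem complete_Metric_space_classes: "Metric_space Q dQ \<and> Metric_space.mcomplete Q dQ"
proof -
  interpret M: Metric_space Q dQ by (rule Metric_space_classes)
  have "M.mcomplete"
    unfolding M.mcomplete_def
  proof (intro allI impI)
    fix \<sigma> assume C: "M.MCauchy \<sigma>"
    then have "\<forall>n. \<sigma> n \<in> Q" unfolding M.MCauchy_def by auto
    then have "\<forall>n. \<exists>f\<in>S. \<sigma> n = cls f" by (meson quotientE)
    then obtain f where f: "\<And>n. f n \<in> S" "\<And>n. \<sigma> n = cls (f n)" by metis
    have "\<exists>N. \<forall>n\<ge>N. \<forall>m\<ge>N. d (f n) (f m) < \<epsilon>" if "0 < \<epsilon>" for \<epsilon>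
    proof -
      obtain N where "\<And>n m. N \<le> n \<Longrightarrow> N \<le> m \<Longrightarrow> dQ (\<sigma> n) (\<sigma> m) < \<epsilon>"
        using C \<open>0 < \<epsilon>\<close> unfolding M.MCauchy_def by meson
      moreover have "dQ (\<sigma> n) (\<sigma> m) = d (f n) (f m)" for n m
        using class_dist_cls f by simp
      ultimately show ?thesis by (intro exI[of _ N]) simp
    qed
    then obtain g where g: "g \<in> S" "\<And>\<epsilon>. 0 < \<epsilon> \<Longrightarrow> \<exists>N. \<forall>n\<ge>N. d (f n) g \<le> \<epsilon>"
      using Cauchy_imp_limit[of f] f(1) by blast
    have "limitin M.mtopology \<sigma> (cls g) sequentially"
      unfolding M.limit_metric_sequentially
    proof (intro conjI allI impI)
      show "cls g \<in> Q" using g(1) by (rule quotientI)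
      fix \<epsilon> :: real assume "0 < \<epsilon>"
      then obtain N where N: "\<forall>n\<ge>N. d (f n) g \<le> \<epsilon> / 2" using g(2)[of "\<epsilon> / 2"] by auto
      have "\<sigma> n \<in> Q \<and> dQ (\<sigma> n) (cls g) < \<epsilon>" if "N \<le> n" for n
      proof -
        have "d (f n) g < \<epsilon>" using N that \<open>0 < \<epsilon>\<close> by fastforce
        then show ?thesis using class_dist_cls[OF f(1) g(1)] f by (auto intro: quotientI)
      qed
      then show "\<exists>N. \<forall>n\<ge>N. \<sigma> n \<in> Q \<and> dQ (\<sigma> n) (cls g) < \<epsilon>" by blast
    qed
    then show "\<exists>x. limitin M.mtopology \<sigma> x sequentially" by blast
  qed
  then show ?thesis using M.Metric_space_axioms by blast
qed

end

section \<open>Norms that are linear on the cones of a fan\<close>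

text \<open>The optimal constants \<open>l\<close> and \<open>u\<close> are attained, and \<open>u \<le> e\<^sup>r l\<close> compares every quotient
  \<open>q(y) / p(y)\<close> with every quotient \<open>q(x) / p(x)\<close>. Conversely, those comparisons make
  \<open>e\<^sup>r q(x) / p(x)\<close> an admissible upper constant for each \<open>x \<noteq> 0\<close>, so that
  \<open>u / e\<^sup>r\<close> is an admissible lower one.\<close>

lemma norm_dist_le_iff:
  fixes p q :: "'a::real_normed_vector \<Rightarrow> real"
  assumes p: "p \<in> equivalent_norms" and q: "q \<in> equivalent_norms" and z: "(z :: 'a) \<noteq> 0"
  shows "norm_dist p q \<le> r \<longleftrightarrow> (\<forall>x\<in>-{0}. \<forall>y\<in>-{0}. p x * q y \<le> exp r * (p y * q x))"
proof -
  obtain a b where ab: "0 < a" "0 < b" "\<And>x. a * norm x \<le> p x" "\<And>x. p x \<le> b * norm x"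
    using p unfolding equivalent_norms_def by blast
  obtain a' b' where ab': "0 < a'" "0 < b'" "\<And>x. a' * norm x \<le> q x" "\<And>x. q x \<le> b' * norm x"
    using q unfolding equivalent_norms_def by blast
  have pos: "0 < p x" "0 < q x" if "x \<noteq> 0" for x
    using that ab(1,3) ab'(1,3) by (meson mult_pos_pos zero_less_norm_iff less_le_trans)+
  have zero: "p 0 = 0" "q 0 = 0" using p q unfolding equivalent_norms_def by auto
  define A where "A = {l. 0 < l \<and> (\<forall>x. l * p x \<le> q x)}"
  define B where "B = {u. 0 < u \<and> (\<forall>x. q x \<le> u * p x)}"
  define l where "l = Sup A"
  define u where "u = Inf B"
  have "a' / b * p x \<le> q x" for x
  proof -
    have "a' / b * p x \<le> a' / b * (b * norm x)" using ab ab' by (intro mult_left_mono) auto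
    also have "\<dots> = a' * norm x" using ab by simp
    finally show ?thesis using ab'(3)[of x] by linarith
  qed
  then have A0: "a' / b \<in> A" using ab ab' unfolding A_def by auto
  have "q x \<le> b' / a * p x" for x
  proof -
    have "b' / a * (a * norm x) \<le> b' / a * p x" using ab ab' by (intro mult_left_mono) auto
    moreover have "b' / a * (a * norm x) = b' * norm x" using ab by simp
    ultimately show ?thesis using ab'(4)[of x] by linarith
  qed
  then have B0: "b' / a \<in> B" using ab ab' unfolding B_def by auto
  have bddA: "bdd_above A"
    by (rule bdd_aboveI[of _ "q z / p z"]) (use pos[OF z] in \<open>auto simp: A_def field_simps\<close>)
  have bddB: "bdd_below B" by (rule bdd_belowI[of _ 0]) (auto simp: B_def)
  have l0: "0 < l" using cSup_upper[OF A0 bddA] ab(2) ab'(1) unfolding l_def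
    by (meson divide_pos_pos less_le_trans)
  have l: "l * p x \<le> q x" for x
  proof (cases "x = 0")
    case False
    have "l \<le> q x / p x" unfolding l_def
      by (rule cSup_least) (use A0 pos[OF False] in \<open>auto simp: A_def field_simps\<close>)
    then show ?thesis using pos[OF False] by (simp add: field_simps)
  qed (simp add: zero)
  have u: "q x \<le> u * p x" for x
  proof (cases "x = 0")
    case False
    have "q x / p x \<le> u" unfolding u_def
      by (rule cInf_greatest) (use B0 pos[OF False] in \<open>auto simp: B_def field_simps\<close>)
    then show ?thesis using pos[OF False] by (simp add: field_simps)
  qed (simp add: zero)
  have "0 < u * p z" using u[of z] pos(2)[OF z] by linarith
  then have u0: "0 < u" using pos(1)[OF z] by (rule zero_less_mult_pos2)
  have "norm_dist p q = ln (u / l)"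
    unfolding norm_dist_def Let_def A_def[symmetric] B_def[symmetric] l_def u_def ..
  also have "\<dots> \<le> r \<longleftrightarrow> u / l \<le> exp r"
    using u0 l0 by (metis divide_pos_pos exp_le_cancel_iff exp_ln)
  also have "\<dots> \<longleftrightarrow> u \<le> exp r * l" using l0 by (simp add: field_simps)
  also have "\<dots> \<longleftrightarrow> (\<forall>x\<in>-{0}. \<forall>y\<in>-{0}. p x * q y \<le> exp r * (p y * q x))"
  proof (intro iffI ballI)
    fix x y :: 'a assume ul: "u \<le> exp r * l" and "x \<in> -{0}" "y \<in> -{0}"
    then have xy: "0 < p x" "0 < p y" using pos by auto
    have "p x * q y \<le> p x * (u * p y)" using u[of y] xy by simp
    also have "\<dots> = u * (p x * p y)" by simp
    also have "\<dots> \<le> exp r * l * (p x * p y)" using ul xy by (intro mult_right_mono) auto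
    also have "\<dots> = exp r * (p y * (l * p x))" by simp
    also have "\<dots> \<le> exp r * (p y * q x)" using l[of x] xy by (intro mult_left_mono) auto
    finally show "p x * q y \<le> exp r * (p y * q x)" .
  next
    assume R: "\<forall>x\<in>-{0}. \<forall>y\<in>-{0}. p x * q y \<le> exp r * (p y * q x)"
    have "u / exp r * p x \<le> q x" for x
    proof (cases "x = 0")
      case False
      have "q y \<le> exp r * q x / p x * p y" for y
        using R[rule_format, of x y] pos[OF False] False
        by (cases "y = 0") (auto simp: zero field_simps)
      moreover have "0 < exp r * q x / p x" using pos[OF False] by simp
      ultimately have "exp r * q x / p x \<in> B" unfolding B_def by blast
      then have "u \<le> exp r * q x / p x" unfolding u_def using bddB by (rule cInf_lower)
      then show ?thesis using pos[OF False] by (simp add: field_simps)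
    qed (simp add: zero)
    then have "u / exp r \<in> A" unfolding A_def using u0 by auto
    then have "u / exp r \<le> l" unfolding l_def using bddA by (rule cSup_upper)
    then show "u \<le> exp r * l" by (simp add: field_simps)
  qed
  finally show ?thesis .
qed

text \<open>On a simplicial cone, agreeing with a linear functional is a condition that involves the function
  only (additivity and positive homogeneity), since any values on the independent
  generators extend linearly. The functionals of the approximating functions need not converge, as
  they are determined only on the span of the cone.\<close>

lemma linear_on_simplicial_cone_limit:
  fixes p :: "'a::real_vector \<Rightarrow> real"
  assumes G: "independent G"
    and lin: "\<And>n::nat. \<exists>l. linear l \<and> (\<forall>x\<in>convex_cone hull G. f n x = l x)"
    and lim: "\<And>x. (\<lambda>n. c n * f n x) \<longlonglongrightarrow> p x"
  shows "\<exists>l. linear l \<and> (\<forall>x\<in>convex_cone hull G. p x = l x)"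
proof -
  define C where "C = convex_cone hull G"
  have C: "convex_cone C" unfolding C_def by (rule convex_cone_convex_cone_hull)
  have add: "p (x + y) = p x + p y" if xy: "x \<in> C" "y \<in> C" for x y
  proof (rule LIMSEQ_unique[OF lim])
    have "f n (x + y) = f n x + f n y" for n
    proof -
      obtain l where "linear l" "\<forall>x\<in>C. f n x = l x" using lin[of n] unfolding C_def by blast
      then show ?thesis using xy convex_cone_add[OF C] by (simp add: linear_add)
    qed
    then show "(\<lambda>n. c n * f n (x + y)) \<longlonglongrightarrow> p x + p y"
      using tendsto_add[OF lim[of x] lim[of y]] by (simp add: distrib_left)
  qed
  have scale: "p (t *\<^sub>R x) = t * p x" if x: "x \<in> C" "0 \<le> t" for x t
  proof (rule LIMSEQ_unique[OF lim])
    have "f n (t *\<^sub>R x) = t * f n x" for n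
    proof -
      obtain l where "linear l" "\<forall>x\<in>C. f n x = l x" using lin[of n] unfolding C_def by blast
      then show ?thesis using x convex_cone_scaleR[OF C] by (simp add: linear_cmul)
    qed
    then show "(\<lambda>n. c n * f n (t *\<^sub>R x)) \<longlonglongrightarrow> t * p x"
      using tendsto_mult_left[OF lim[of x], of t] by (simp add: mult_ac)
  qed
  obtain l where l: "linear l" "\<forall>x\<in>G. l x = p x"
    using linear_independent_extend[OF G, of p] by blast
  have "C \<subseteq> {x \<in> C. p x = l x}"
  proof -
    have "convex_cone {x \<in> C. p x = l x}"
      unfolding convex_cone_iff
      using l(1) scale[of 0 0] convex_cone_contains_0[OF C] convex_cone_add[OF C] convex_cone_scaleR[OF C]
      by (auto simp: add scale linear_add linear_cmul linear_0)
    moreover have "G \<subseteq> {x \<in> C. p x = l x}" using l(2) hull_subset[of G convex_cone] unfolding C_def by auto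
    ultimately show "C \<subseteq> {x \<in> C. p x = l x}" unfolding C_def by (intro hull_minimal)
  qed
  then show ?thesis using l(1) unfolding C_def by blast
qed

lemma equivalent_norms_limit:
  fixes p :: "'a::real_normed_vector \<Rightarrow> real"
  assumes f: "\<And>n::nat. f n \<in> equivalent_norms" and c: "\<And>n. 0 < c n"
    and lim: "\<And>x. (\<lambda>n. c n * f n x) \<longlonglongrightarrow> p x"
    and ab: "0 < a" "0 < b" "\<And>x. a * f N x \<le> p x" "\<And>x. p x \<le> b * f N x"
  shows "p \<in> equivalent_norms"
proof -
  obtain a' b' where ab': "0 < a'" "0 < b'" "\<And>x. a' * norm x \<le> f N x" "\<And>x. f N x \<le> b' * norm x"
    using f[of N] unfolding equivalent_norms_def by blast
  have lower: "(a * a') * norm x \<le> p x" for x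
    using order_trans[OF mult_left_mono[OF ab'(3) less_imp_le[OF ab(1)]] ab(3)] by (simp add: mult.assoc)
  have upper: "p x \<le> (b * b') * norm x" for x
    using order_trans[OF ab(4) mult_left_mono[OF ab'(4) less_imp_le[OF ab(2)]]] by (simp add: mult.assoc)
  have pos: "0 < a * a'" "0 < b * b'" using ab ab' by auto
  have "p x = 0 \<longleftrightarrow> x = 0" for x
  proof
    assume "p x = 0"
    then have "(a * a') * norm x \<le> 0" using lower[of x] by simp
    then show "x = 0" using ab(1) ab'(1) by (simp add: mult_le_0_iff)
  next
    assume "x = 0"
    then show "p x = 0" using lower[of x] upper[of x] by simp
  qed
  moreover have "p (x + y) \<le> p x + p y" for x y
  proof (rule LIMSEQ_le[OF lim])
    show "(\<lambda>n. c n * f n x + c n * f n y) \<longlonglongrightarrow> p x + p y" by (intro tendsto_add lim)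
    have "f n (x + y) \<le> f n x + f n y" for n using f[of n] unfolding equivalent_norms_def by blast
    then have "c n * f n (x + y) \<le> c n * f n x + c n * f n y" for n
      using c[of n] by (simp add: distrib_left[symmetric])
    then show "\<exists>M. \<forall>n\<ge>M. c n * f n (x + y) \<le> c n * f n x + c n * f n y" by blast
  qed
  moreover have "p (t *\<^sub>R x) = \<bar>t\<bar> * p x" for t x
  proof (rule LIMSEQ_unique[OF lim])
    have "f n (t *\<^sub>R x) = \<bar>t\<bar> * f n x" for n using f[of n] unfolding equivalent_norms_def by blast
    then show "(\<lambda>n. c n * f n (t *\<^sub>R x)) \<longlonglongrightarrow> \<bar>t\<bar> * p x"
      using tendsto_mult_left[OF lim[of x], of "\<bar>t\<bar>"] by (simp add: mult_ac)
  qed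
  moreover have "\<exists>a>0. \<exists>b>0. \<forall>x. a * norm x \<le> p x \<and> p x \<le> b * norm x"
    using pos lower upper by (intro exI[of _ "a * a'"] exI[of _ "b * b'"] conjI allI)
  ultimately show ?thesis unfolding equivalent_norms_def by simp
qed

lemma projective_metric_fan_norms:
  fixes F :: "'a::real_normed_vector set set"
  assumes z: "(z :: 'a) \<noteq> 0" and F: "simplicial_fan F"
  shows "projective_metric (-{0}) (fan_norms F) norm_dist"
proof
  show "- {0 :: 'a} \<noteq> {}" using z by auto
next
  fix f and x :: 'a assume "f \<in> fan_norms F" and x: "x \<in> -{0}"
  then obtain a where a: "0 < a" "a * norm x \<le> f x" unfolding fan_norms_def equivalent_norms_def by blast
  have "0 < a * norm x" using a(1) x by simp
  then show "0 < f x" using a(2) by linarith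
next
  fix f g r assume "f \<in> fan_norms F" "g \<in> fan_norms F"
  then have "f \<in> equivalent_norms" "g \<in> equivalent_norms" unfolding fan_norms_def by auto
  then show "norm_dist f g \<le> r \<longleftrightarrow> (\<forall>x\<in>-{0}. \<forall>y\<in>-{0}. f x * g y \<le> exp r * (f y * g x))"
    using z by (rule norm_dist_le_iff)
next
  fix f c h N and a b :: real
  assume f: "\<And>n::nat. f n \<in> fan_norms F" and c: "\<And>n. 0 < c n"
    and lim: "\<And>x. x \<in> -{0} \<Longrightarrow> (\<lambda>n. c n * f n x) \<longlonglongrightarrow> h x"
    and ab: "0 < a" "0 < b" "\<And>x. x \<in> -{0} \<Longrightarrow> a * f N x \<le> h x \<and> h x \<le> b * f N x"
  have zero: "f n 0 = 0" for n using f[of n] unfolding fan_norms_def equivalent_norms_def by blast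
  \<comment> \<open>The function \<open>h\<close> is a limit only away from 0, so its value at 0 is arbitrary.\<close>
  define p where "p = h(0 := 0)"
  have lim': "(\<lambda>n. c n * f n x) \<longlonglongrightarrow> p x" for x
    using lim[of x] by (cases "x = 0") (auto simp: p_def zero)
  have "p \<in> equivalent_norms"
  proof (rule equivalent_norms_limit[OF _ c lim' ab(1,2)])
    show "f n \<in> equivalent_norms" for n using f unfolding fan_norms_def by auto
    show "a * f N x \<le> p x" "p x \<le> b * f N x" for x using ab(3)[of x] by (auto simp: p_def zero)
  qed
  moreover have "\<exists>l. linear l \<and> (\<forall>x\<in>C. p x = l x)" if "C \<in> F" for C
  proof -
    obtain G where "independent G" "C = convex_cone hull G"
      using F \<open>C \<in> F\<close> unfolding simplicial_fan_def by blast
    moreover have "\<exists>l. linear l \<and> (\<forall>x\<in>C. f n x = l x)" for n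
      using f[of n] \<open>C \<in> F\<close> unfolding fan_norms_def by blast
    ultimately show ?thesis using linear_on_simplicial_cone_limit[of G f c p] lim' by blast
  qed
  ultimately have "p \<in> fan_norms F" unfolding fan_norms_def by blast
  then show "\<exists>g\<in>fan_norms F. \<forall>x\<in>-{0}. g x = h x" by (intro bexI[of _ p]) (auto simp: p_def)
qed

text \<open>Quotients of norms make sense only at nonzero vectors, so the projective metric is set up there.\<close>

lemma proportionality_fan_norms:
  "proportionality UNIV (fan_norms F) = proportionality (-{0}) (fan_norms F)"
proof -
  have "(\<forall>x. g x = c * f x) \<longleftrightarrow> (\<forall>x\<in>-{0}. g x = c * f x)"
    if "f \<in> fan_norms F" "g \<in> fan_norms F" for f g :: "'a \<Rightarrow> real" and c
  proof -
    have "f 0 = 0" "g 0 = 0" using that unfolding fan_norms_def equivalent_norms_def by auto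
    then show ?thesis by (metis ComplI mult_zero_right singletonD)
  qed
  then show ?thesis unfolding proportionality_def by auto
qed

section \<open>Admissible weights\<close>

text \<open>A linear functional takes finitely many values on \<open>E\<close>; a bound for them holds on the
  convex hull, which contains a ball. The constant 4 combines a factor 2 from moving the centre of the ball
  to 0 and a factor 2 from using half its radius.\<close>

lemma linear_bounded_of_direction_set:
  fixes E :: "'a::real_normed_vector set" and l :: "'a \<Rightarrow> real"
  assumes E: "direction_set E" and l: "linear l"
  shows "bounded_linear l"
proof -
  obtain z r where r: "0 < r" "ball z r \<subseteq> convex hull E"
    using E unfolding direction_set_def by (metis ex_in_conv mem_interior)
  define M where "M = (\<Sum>x\<in>E. \<bar>l x\<bar>)"
  have "E \<subseteq> l -` {-M..M}"
  proof
    fix x assume "x \<in> E"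
    then have "\<bar>l x\<bar> \<le> M" unfolding M_def using E unfolding direction_set_def
      by (intro member_le_sum) auto
    then show "x \<in> l -` {-M..M}" by auto
  qed
  moreover have "convex (l -` {-M..M})" using l by (rule convex_linear_vimage) simp
  ultimately have "convex hull E \<subseteq> l -` {-M..M}" by (rule hull_minimal)
  then have M: "\<bar>l y\<bar> \<le> M" if "dist z y < r" for y using r(2) that by (auto simp: subset_iff)
  have "\<bar>l x\<bar> \<le> norm x * (4 * M / r)" for x
  proof (cases "x = 0")
    case False
    \<comment> \<open>Shrink \<open>x\<close> to length \<open>r / 2\<close>, so that adding it to the centre stays inside the ball.\<close>
    define t where "t = r / (2 * norm x)"
    have t: "0 < t" using r(1) False unfolding t_def by simp
    have "norm (t *\<^sub>R x) = r / 2" using False r(1) unfolding t_def by simp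
    then have "dist z (z + t *\<^sub>R x) < r" using r(1) by (simp add: dist_norm)
    then have "\<bar>l (z + t *\<^sub>R x)\<bar> \<le> M" "\<bar>l z\<bar> \<le> M" using M r(1) by auto
    then have "\<bar>t * l x\<bar> \<le> 2 * M" using l by (simp add: linear_add linear_cmul)
    then have "t * \<bar>l x\<bar> \<le> 2 * M" using t by (simp add: abs_mult)
    then show ?thesis using False r(1) unfolding t_def by (simp add: field_simps)
  qed (simp add: linear_0[OF l])
  then show ?thesis
    using l by (intro bounded_linear_intro[of l "4 * M / r"]) (simp_all add: linear_add linear_cmul)
qed

text \<open>The finite spanning set \<open>B\<close> rules out infinite dimension, where \<open>dim\<close> and the
  cardinality of the empty set are both 0.\<close>

lemma independent_card_eq_dim_spans:
  fixes B G :: "'a::real_vector set"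
  assumes B: "finite B" "span B = UNIV" and G: "independent G" "card G = dim (UNIV :: 'a set)"
  shows "span G = UNIV"
proof -
  obtain H where H: "G \<subseteq> H" "independent H" "span H = UNIV"
    using maximal_independent_subset_extend[OF subset_UNIV G(1)] by (metis top.extremum_unique)
  have "finite H" using independent_span_bound[OF B(1) H(2)] B(2) by auto
  moreover have "card H = dim (UNIV :: 'a set)" using dim_eq_card[of H UNIV] H by auto
  ultimately have "G = H" using H(1) G(2) by (intro card_subset_eq) auto
  then show ?thesis using H(3) by simp
qed

lemma cone_functional_coordinates:
  fixes E G :: "'a::real_normed_vector set"
  assumes E: "direction_set E" and G: "independent G" "span G = UNIV" "finite G"
  shows "blinfun_apply (cone_functional G \<alpha>) v = (\<Sum>g\<in>G. representation G v g * \<alpha> g)"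
proof -
  obtain l where l: "linear l" "\<forall>g\<in>G. l g = \<alpha> g"
    using linear_independent_extend[OF G(1), of \<alpha>] by blast
  have app: "blinfun_apply (Blinfun l) = l"
    by (rule bounded_linear_Blinfun_apply[OF linear_bounded_of_direction_set[OF E l(1)]])
  have "cone_functional G \<alpha> = Blinfun l"
    unfolding cone_functional_def
  proof (rule the_equality)
    show "\<forall>g\<in>G. blinfun_apply (Blinfun l) g = \<alpha> g" using l(2) app by simp
    fix m :: "'a \<Rightarrow>\<^sub>L real" assume m: "\<forall>g\<in>G. blinfun_apply m g = \<alpha> g"
    have "blinfun_apply m x = l x" for x
    proof (rule linear_eq_on_span[of "blinfun_apply m" l G])
      show "linear (blinfun_apply m)" by (rule bounded_linear.linear) (rule blinfun.bounded_linear_right)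
    qed (use l m G(2) in auto)
    then show "m = Blinfun l" using app by (intro blinfun_eqI) simp
  qed
  moreover have "l v = (\<Sum>g\<in>G. representation G v g * \<alpha> g)"
  proof -
    have "v = (\<Sum>g\<in>G. representation G v g *\<^sub>R g)"
      using sum_representation_eq[OF G(1) _ G(3) order_refl, of v] G(2) by simp
    then have "l v = l (\<Sum>g\<in>G. representation G v g *\<^sub>R g)" by simp
    also have "\<dots> = (\<Sum>g\<in>G. representation G v g * \<alpha> g)"
      using l by (simp add: linear_sum linear_cmul)
    finally show ?thesis .
  qed
  ultimately show ?thesis using app by simp
qed

lemma admissible_weights_limit:
  fixes E :: "'a::real_normed_vector set"
  assumes B: "finite B" "span B = (UNIV :: 'a set)" and E: "direction_set E"
    and f: "\<And>n::nat. f n \<in> admissible_weights E F" and c: "\<And>n. 0 < c n"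
    and lim: "\<And>x. x \<in> E \<Longrightarrow> (\<lambda>n. c n * f n x) \<longlonglongrightarrow> h x" and h: "\<And>x. x \<in> E \<Longrightarrow> 0 < h x"
  shows "restrict h E \<in> admissible_weights E F"
proof -
  have neg: "- x \<in> E" if "x \<in> E" for x using E that unfolding direction_set_def by blast
  have "h (- x) = h x" if x: "x \<in> E" for x
  proof -
    have "f n (- x) = f n x" for n
      using f[of n] x unfolding admissible_weights_def symmetric_weights_def by blast
    then show ?thesis using LIMSEQ_unique lim[OF x] lim[OF neg[OF x]] by simp
  qed
  then have "restrict h E \<in> symmetric_weights E"
    unfolding symmetric_weights_def using h neg by auto
  moreover have "E_admissible E F (restrict h E)"
    unfolding E_admissible_def
  proof (intro allI impI ballI, elim conjE)
    fix C G x
    assume C: "maximal_cone F C" "C = convex_cone hull G" and G: "G \<subseteq> E" "independent G" "card G = dim (UNIV :: 'a set)"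
      and x: "x \<in> E"
    have G': "span G = UNIV" "finite G"
      using independent_card_eq_dim_spans[OF B G(2,3)] G(1) E finite_subset
      unfolding direction_set_def by auto
    note coord = cone_functional_coordinates[OF E G(2) G']
    have "(\<Sum>g\<in>G. representation G x g * h g) \<le> h x"
    proof (rule LIMSEQ_le[OF _ lim[OF x]])
      show "(\<lambda>n. \<Sum>g\<in>G. representation G x g * (c n * f n g)) \<longlonglongrightarrow> (\<Sum>g\<in>G. representation G x g * h g)"
        by (intro tendsto_intros lim) (use G(1) in auto)
      have "(\<Sum>g\<in>G. representation G x g * (c n * f n g)) \<le> c n * f n x" for n
      proof -
        have "(\<Sum>g\<in>G. representation G x g * f n g) \<le> f n x"
          using f[of n] C G x coord[of "f n"] unfolding admissible_weights_def E_admissible_def by force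
        then have "c n * (\<Sum>g\<in>G. representation G x g * f n g) \<le> c n * f n x"
          using c[of n] by simp
        then show ?thesis by (simp add: sum_distrib_left mult_ac)
      qed
      then show "\<exists>M. \<forall>n\<ge>M. (\<Sum>g\<in>G. representation G x g * (c n * f n g)) \<le> c n * f n x" by blast
    qed
    moreover have "(\<Sum>g\<in>G. representation G x g * restrict h E g) = (\<Sum>g\<in>G. representation G x g * h g)"
      by (rule sum.cong) (use G(1) in auto)
    ultimately show "blinfun_apply (cone_functional G (restrict h E)) x \<le> restrict h E x"
      using x by (simp add: coord)
  qed
  ultimately show ?thesis unfolding admissible_weights_def by blast
qed

lemma hilbert_dist_le_iff:
  assumes k: "1 \<le> k" and pos: "\<And>i. i \<in> {1..k} \<Longrightarrow> 0 < a i \<and> 0 < b i"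
  shows "hilbert_dist k a b \<le> r \<longleftrightarrow> (\<forall>i\<in>{1..k}. \<forall>j\<in>{1..k}. a i * b j \<le> exp r * (a j * b i))"
proof -
  define R where "R = (\<lambda>i. a i / b i) ` {1..k}"
  have R: "finite R" "R \<noteq> {}" "\<And>t. t \<in> R \<Longrightarrow> 0 < t" using k pos unfolding R_def by auto
  have m: "0 < Min R" "0 < Max R" using R by (auto simp: Max_gr_iff)
  have "hilbert_dist k a b \<le> r \<longleftrightarrow> Max R / Min R \<le> exp r"
    unfolding hilbert_dist_def R_def[symmetric] using m by (metis divide_pos_pos exp_le_cancel_iff exp_ln)
  also have "\<dots> \<longleftrightarrow> Max R \<le> exp r * Min R" using m by (simp add: field_simps)
  also have "\<dots> \<longleftrightarrow> (\<forall>s\<in>R. \<forall>t\<in>R. s \<le> exp r * t)"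
  proof
    assume M: "Max R \<le> exp r * Min R"
    show "\<forall>s\<in>R. \<forall>t\<in>R. s \<le> exp r * t"
    proof (intro ballI)
      fix s t assume "s \<in> R" "t \<in> R"
      then have "s \<le> Max R" "exp r * Min R \<le> exp r * t" using R by auto
      then show "s \<le> exp r * t" using M by linarith
    qed
  qed (use R in auto)
  also have "\<dots> \<longleftrightarrow> (\<forall>i\<in>{1..k}. \<forall>j\<in>{1..k}. a i / b i \<le> exp r * (a j / b j))" unfolding R_def by simp
  also have "\<dots> \<longleftrightarrow> (\<forall>i\<in>{1..k}. \<forall>j\<in>{1..k}. a i * b j \<le> exp r * (a j * b i))"
  proof (intro ball_cong refl)
    fix i j assume "i \<in> {1..k}" "j \<in> {1..k}"
    then have "0 < b i" "0 < b j" using pos by auto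
    then show "a i / b i \<le> exp r * (a j / b j) \<longleftrightarrow> a i * b j \<le> exp r * (a j * b i)"
      by (simp add: field_simps)
  qed
  finally show ?thesis .
qed

text \<open>The Hilbert metric sees one direction of each antipodal pair only; by symmetry of the weights the
  inequalities for these directions are the inequalities for all of \<open>E\<close>.\<close>

lemma projective_metric_admissible_weights:
  fixes E :: "'a::real_normed_vector set"
  assumes B: "finite B" "span B = (UNIV :: 'a set)" and E: "direction_set E"
    and Ex: "E = (\<Union>i\<in>{1..k}. {x i, - x i})"
  shows "projective_metric E (admissible_weights E F) (weight_dist k x)"
proof
  show ne: "E \<noteq> {}" using E unfolding direction_set_def by auto
  show pos: "0 < f y" if "f \<in> admissible_weights E F" "y \<in> E" for f y
    using that unfolding admissible_weights_def symmetric_weights_def by auto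
  show "weight_dist k x f g \<le> r \<longleftrightarrow> (\<forall>y\<in>E. \<forall>z\<in>E. f y * g z \<le> exp r * (f z * g y))"
    if fg: "f \<in> admissible_weights E F" "g \<in> admissible_weights E F" for f g r
  proof -
    have k: "1 \<le> k" using ne Ex by (cases k) auto
    have xE: "x i \<in> E" if "i \<in> {1..k}" for i using Ex that by blast
    have sym: "f (- x i) = f (x i)" "g (- x i) = g (x i)" if "i \<in> {1..k}" for i
      using fg xE[OF that] unfolding admissible_weights_def symmetric_weights_def by auto
    have "weight_dist k x f g \<le> r \<longleftrightarrow>
        (\<forall>i\<in>{1..k}. \<forall>j\<in>{1..k}. f (x i) * g (x j) \<le> exp r * (f (x j) * g (x i)))"
      unfolding weight_dist_def by (rule hilbert_dist_le_iff) (use k pos fg xE in auto)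
    also have "\<dots> \<longleftrightarrow> (\<forall>y\<in>E. \<forall>z\<in>E. f y * g z \<le> exp r * (f z * g y))"
      using sym by (subst (1 2) Ex) simp
    finally show ?thesis .
  qed
  show "\<exists>g\<in>admissible_weights E F. \<forall>y\<in>E. g y = h y"
    if "\<And>n::nat. f n \<in> admissible_weights E F" "\<And>n. 0 < c n"
      "\<And>y. y \<in> E \<Longrightarrow> (\<lambda>n. c n * f n y) \<longlonglongrightarrow> h y" "\<And>y. y \<in> E \<Longrightarrow> 0 < h y" for f c h
    using admissible_weights_limit[OF B E that] by (intro bexI[of _ "restrict h E"]) auto
qed

section \<open>Completeness of both quotients\<close>

theorem corollary6p4:
  fixes E :: "'a::banach set" and F :: "'a set set" and x :: "nat \<Rightarrow> 'a" and k :: nat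
  assumes "\<exists>B :: 'a set. finite B \<and> span B = UNIV"
    and "direction_set E"
    and "card E = 2 * k"
    and "E = (\<Union>i\<in>{1..k}. {x i, - x i})"
    and "complete_fan F" and "symmetric_fan F" and "simplicial_fan F" and "E_fan E F"
  shows "(let R = admissible_weight_classes E F; d = class_dist R (weight_dist k x)
          in Metric_space R d \<and> Metric_space.mcomplete R d) \<and>
         (let N = fan_norm_classes F; d = class_dist N norm_dist
          in Metric_space N d \<and> Metric_space.mcomplete N d)"
proof -
  obtain B :: "'a set" where B: "finite B" "span B = UNIV" using assms(1) by blast
  interpret R: projective_metric E "admissible_weights E F" "weight_dist k x"
    by (rule projective_metric_admissible_weights[OF B assms(2,4)])
  obtain z where "z \<in> E" using R.nonempty by blast
  then have "z \<noteq> 0" using assms(2) unfolding direction_set_def by auto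
  then interpret N: projective_metric "-{0}" "fan_norms F" norm_dist
    by (rule projective_metric_fan_norms[OF _ assms(7)])
  show ?thesis
    unfolding Let_def admissible_weight_classes_def fan_norm_classes_def proportionality_fan_norms
    using R.complete_Metric_space_classes N.complete_Metric_space_classes by (rule conjI)
qed

end
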